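(* Let $\lambda$ be a nonzero real number and let $n,r\ge 0$ be integers. Then, as functions of $x$, \[ \frac{1}{e^{x}}\,(XD+r)_{n,\lambda}\,e^{x}=\phi^{(r)}_{n,\lambda}(x), \] where $X$ is the operator of multiplication by $x$, $D=\frac{d}{dx}$, and $(XD+r)_{n,\lambda}$ is the operator $(XD+r)(XD+r-\lambda)\cdots(XD+r-(n-1)\lambda)$ (the identity operator when $n=0$).
   Context: For nonzero real $\lambda$, the degenerate falling factorial is $(x)_{0,\lambda}=1$, $(x)_{n,\lambda}=x(x-\lambda)(x-2\lambda)\cdots(x-(n-1)\lambda)$ for $n\ge1$. The degenerate exponentials are the formal power series $e_\lambda^{x}(t)=\sum_{n\ge0}(x)_{n,\lambda}\frac{t^n}{n!}$ and $e_\lambda(t)=e_\lambda^{1}(t)$. For a nonnegative integer $r$, the degenerate $r$-Stirling numbers of the second kind ${n+r\brace k+r}_{r,\lambda}$ are defined by $(x+r)_{n,\lambda}=\sum_{k=0}^n {n+r\brace k+r}_{r,\lambda}(x)_k$, with $(x)_k=x(x-1)\cdots(x-k+1)$, $(x)_0=1$. The degenerate $r$-Bell polynomials are defined by $e^{x(e_\lambda(t)-1)}e_\lambda^{r}(t)=\sum_{n\ge0}\phi^{(r)}_{n,\lambda}(x)\frac{t^n}{n!}$; equivalently $\phi^{(r)}_{n,\lambda}(x)=\sum_{k=0}^n {n+r\brace k+r}_{r,\lambda}x^k$. *)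

theory Defs
  imports
    "HOL-Analysis.Analysis"
    "HOL-Computational_Algebra.Formal_Power_Series"
begin

definition degen_ffact :: "real \<Rightarrow> real \<Rightarrow> nat \<Rightarrow> real" where
  "degen_ffact l x n = (\<Prod>i<n. x - real i * l)"

definition degen_exp :: "real \<Rightarrow> real \<Rightarrow> real fps" where
  "degen_exp l x = Abs_fps (\<lambda>n. degen_ffact l x n / fact n)"

(* The inner series degen_exp l 1 - 1 has zero constant term, so the formal
   composition really is the exponential series of x * (degen_exp l 1 - 1). *)
definition degen_r_Bell_gf :: "real \<Rightarrow> nat \<Rightarrow> real \<Rightarrow> real fps" where
  "degen_r_Bell_gf l r x = (fps_exp x oo (degen_exp l 1 - 1)) * degen_exp l (real r)"

definition degen_r_Bell :: "real \<Rightarrow> nat \<Rightarrow> nat \<Rightarrow> real \<Rightarrow> real" where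
  "degen_r_Bell l r n x = fact n * fps_nth (degen_r_Bell_gf l r x) n"

lemma degen_exp_1_minus_1_nth_0: "fps_nth (degen_exp l 1 - 1) 0 = 0"
  by (simp add: degen_exp_def degen_ffact_def)

lemma degen_r_Bell_gf_eq:
  "degen_r_Bell_gf l r x = Abs_fps (\<lambda>n. degen_r_Bell l r n x / fact n)"
  by (rule fps_ext) (simp add: degen_r_Bell_def)

type_synonym fun_op = "(real \<Rightarrow> real) \<Rightarrow> (real \<Rightarrow> real)"

definition X_op :: fun_op where
  "X_op f = (\<lambda>x. x * f x)"

definition D_op :: fun_op where
  "D_op f = deriv f"

definition add_scalar_op :: "fun_op \<Rightarrow> real \<Rightarrow> fun_op" where
  "add_scalar_op T c f = (\<lambda>x. T f x + c * f x)"

(* T (T - l) ... (T - (n-1) l), the rightmost factor being applied first. *)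
primrec degen_ffact_op :: "real \<Rightarrow> fun_op \<Rightarrow> nat \<Rightarrow> fun_op" where
  "degen_ffact_op l T 0 = id"
| "degen_ffact_op l T (Suc n) = degen_ffact_op l T n \<circ> add_scalar_op T (- (real n * l))"

end

theory Submission
  imports Defs
begin

text \<open>
  The generating function $F_x$ of $\phi^{(r)}_{n,\lambda}(x)$ satisfies
  $(1 + \lambda t)\,\partial_t F_x = (x\,e_\lambda(t) + r)\,F_x$ and
  $\partial_x F_x = (e_\lambda(t) - 1)\,F_x$. Eliminating $e_\lambda(t)\,F_x$ gives
  $\phi_{n+1} = x\,(\phi_n' + \phi_n) + (r - n\lambda)\,\phi_n$, and this is the result of applying
  $XD + r - n\lambda$ to $\phi_n e^x$ and dividing by $e^x$. The factors of the operator product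
  commute on functions of the form $p(x)\,e^x$ with $p$ a polynomial, so the factor with index $n$
  may be applied last.
\<close>

text \<open>Comparing coefficients reduces this to one more factor \<open>x - real n * l\<close> in
  the falling factorial; the part \<open>real n * l\<close> comes from
  \<open>fps_X * fps_deriv\<close>.\<close>

lemma degen_exp_ode:
  "(1 + fps_const l * fps_X) * fps_deriv (degen_exp l x) = fps_const x * degen_exp l x"
proof (rule fps_ext)
  fix n
  define a where "a = fps_nth (degen_exp l x)"
  have "real (Suc n) * a (Suc n) = (x - real n * l) * a n"
    by (simp add: a_def degen_exp_def degen_ffact_def del: of_nat_Suc)
  then show "fps_nth ((1 + fps_const l * fps_X) * fps_deriv (degen_exp l x)) n =
      fps_nth (fps_const x * degen_exp l x) n"
    by (cases n) (simp_all add: distrib_right mult.assoc flip: a_def, simp_all add: algebra_simps)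
qed

lemma degen_r_Bell_gf_ode:
  "(1 + fps_const l * fps_X) * fps_deriv (degen_r_Bell_gf l r x) =
     fps_const x * (degen_exp l 1 * degen_r_Bell_gf l r x) + fps_const (real r) * degen_r_Bell_gf l r x"
proof -
  define E where "E = degen_exp l 1"
  define R where "R = degen_exp l (real r)"
  define G where "G = fps_exp x oo (E - 1)"
  define L where "L = 1 + fps_const l * fps_X"
  have G': "fps_deriv G = fps_const x * G * fps_deriv E"
    unfolding G_def E_def
    by (subst fps_compose_deriv)
      (simp_all add: degen_exp_1_minus_1_nth_0 fps_compose_mult_distrib del: fps_sub_nth)
  \<comment> \<open>Both summands of the product rule now contain \<open>L\<close> times the
    derivative of a degenerate exponential, so \<open>degen_exp_ode\<close> applies to each.\<close>
  have "L * fps_deriv (G * R) = fps_const x * G * R * (L * fps_deriv E) + G * (L * fps_deriv R)"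
    by (simp add: G' algebra_simps)
  also have "\<dots> = fps_const x * (E * (G * R)) + fps_const (real r) * (G * R)"
    unfolding L_def E_def R_def degen_exp_ode by (simp add: algebra_simps)
  finally show ?thesis
    by (simp add: degen_r_Bell_gf_def E_def R_def G_def L_def)
qed

lemma fps_exp_nth_has_real_derivative:
  "((\<lambda>x. fps_nth (fps_exp x) i) has_real_derivative fps_nth (fps_X * fps_exp x) i) (at x)"
proof (cases i)
  case (Suc j)
  have "((\<lambda>x. x ^ Suc j / fact (Suc j)) has_real_derivative x ^ j / fact j) (at x)"
    by (rule DERIV_cong[OF DERIV_cdivide[OF DERIV_pow]]) (simp del: of_nat_Suc)
  then show ?thesis
    using Suc by (simp del: fact_Suc power_Suc)
qed simp

text \<open>Each coefficient is a finite sum of coefficients of \<open>fps_exp x\<close> times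
  factors independent of \<open>x\<close>, so termwise differentiation is legitimate.\<close>

lemma degen_r_Bell_gf_nth_has_real_derivative:
  "((\<lambda>x. fps_nth (degen_r_Bell_gf l r x) n) has_real_derivative
     fps_nth ((degen_exp l 1 - 1) * degen_r_Bell_gf l r x) n) (at x)"
proof -
  define Y where "Y = degen_exp l 1 - 1"
  define R where "R = degen_exp l (real r)"
  have "Y * (fps_exp x oo Y) = (fps_X * fps_exp x) oo Y"
    by (simp add: Y_def fps_compose_mult_distrib degen_exp_1_minus_1_nth_0 del: fps_sub_nth)
  moreover have "((\<lambda>x. fps_nth (fps_exp x oo Y) k) has_real_derivative
      fps_nth ((fps_X * fps_exp x) oo Y) k) (at x)" for k
    unfolding fps_compose_nth
    by (intro DERIV_sum DERIV_cmult_right fps_exp_nth_has_real_derivative)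
  ultimately have "((\<lambda>x. fps_nth ((fps_exp x oo Y) * R) n) has_real_derivative
      fps_nth (Y * (fps_exp x oo Y) * R) n) (at x)"
    unfolding fps_mult_nth[of _ R]
    by (intro DERIV_sum DERIV_cmult_right) simp
  then show ?thesis
    by (simp add: degen_r_Bell_gf_def Y_def R_def mult.assoc)
qed

lemma degen_r_Bell_0: "degen_r_Bell l r 0 x = 1"
  by (simp add: degen_r_Bell_def degen_r_Bell_gf_def degen_exp_def degen_ffact_def)

lemma degen_r_Bell_has_real_derivative:
  "(degen_r_Bell l r n has_real_derivative
     fact n * fps_nth (degen_exp l 1 * degen_r_Bell_gf l r x) n - degen_r_Bell l r n x) (at x)"
  using DERIV_cmult[OF degen_r_Bell_gf_nth_has_real_derivative, of "fact n" l r n x]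
  by (simp add: degen_r_Bell_def[abs_def] algebra_simps)

lemma degen_r_Bell_Suc:
  "degen_r_Bell l r (Suc n) x =
     x * (deriv (degen_r_Bell l r n) x + degen_r_Bell l r n x) + (real r - real n * l) * degen_r_Bell l r n x"
proof -
  define F where "F = degen_r_Bell_gf l r x"
  \<comment> \<open>Isolated because its coefficients, unlike those of \<open>fps_deriv F\<close>,
    involve no index shift; this yields the term \<open>- real n * l\<close>.\<close>
  define G where "G = fps_X * fps_deriv F"
  have G: "fps_nth G n = real n * fps_nth F n"
    by (cases n) (simp_all add: G_def)
  have "fps_deriv F + fps_const l * G = fps_const x * (degen_exp l 1 * F) + fps_const (real r) * F"
    using degen_r_Bell_gf_ode[of l r x] by (simp add: F_def G_def distrib_right mult.assoc)
  from arg_cong[OF this, of "\<lambda>A. fact n * fps_nth A n"]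
  have "degen_r_Bell l r (Suc n) x + l * (fact n * fps_nth G n) =
      x * (fact n * fps_nth (degen_exp l 1 * F) n) + real r * degen_r_Bell l r n x"
    by (simp add: degen_r_Bell_def F_def algebra_simps)
  then show ?thesis
    unfolding G DERIV_imp_deriv[OF degen_r_Bell_has_real_derivative]
    by (simp add: degen_r_Bell_def F_def algebra_simps)
qed

text \<open>The set \<open>S\<close> is there because \<open>T\<close> is an arbitrary map: for
  \<open>X_op \<circ> D_op\<close>, linearity can fail on functions that are not differentiable. The
  induction generalizes \<open>f\<close> since the recursion applies its newest factor
  first.\<close>

lemma degen_ffact_op_commute:
  assumes closed: "\<And>f c. f \<in> S \<Longrightarrow> add_scalar_op T c f \<in> S"
    and linear: "\<And>f c. f \<in> S \<Longrightarrow> T (add_scalar_op T c f) = add_scalar_op T c (T f)"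
    and "f \<in> S"
  shows "degen_ffact_op l T n (add_scalar_op T c f) = add_scalar_op T c (degen_ffact_op l T n f)"
  using \<open>f \<in> S\<close>
proof (induction n arbitrary: f)
  case (Suc n)
  have "add_scalar_op T d (add_scalar_op T c f) = add_scalar_op T c (add_scalar_op T d f)" for d
    using linear[OF Suc.prems] unfolding add_scalar_op_def by (simp add: fun_eq_iff algebra_simps)
  then show ?case
    using Suc.IH[OF closed[OF Suc.prems]] by simp
qed simp

lemma euler_op_mult_exp:
  assumes "\<And>x. (g has_real_derivative g' x) (at x)"
  shows "add_scalar_op (X_op \<circ> D_op) c (\<lambda>x. g x * exp x) =
    (\<lambda>x. (x * (g' x + g x) + c * g x) * exp x)"
proof -
  have "((\<lambda>x. g x * exp x) has_real_derivative (g' x + g x) * exp x) (at x)" for x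
    using DERIV_mult[OF assms DERIV_exp, of x] by (simp add: algebra_simps)
  then have "deriv (\<lambda>x. g x * exp x) x = (g' x + g x) * exp x" for x
    by (rule DERIV_imp_deriv)
  then show ?thesis
    by (simp add: add_scalar_op_def X_op_def D_op_def fun_eq_iff algebra_simps)
qed

lemma add_scalar_op_add_scalar_op:
  "add_scalar_op (add_scalar_op T c) d = add_scalar_op T (c + d)"
  by (simp add: add_scalar_op_def fun_eq_iff algebra_simps)

lemma degen_ffact_op_Suc_exp:
  fixes r :: real
  defines "T \<equiv> add_scalar_op (X_op \<circ> D_op) r"
  shows "degen_ffact_op l T (Suc n) exp =
    add_scalar_op T (- (real n * l)) (degen_ffact_op l T n exp)"
proof -
  \<comment> \<open>\<open>Q c\<close> is the action of XD + c on the polynomial factor of p(x)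
    exp(x): conjugation by exp turns D into D + 1.\<close>
  define Q where "Q = (\<lambda>c p. [:0, 1:] * (pderiv p + p) + smult c p :: real poly)"
  define S where "S = range (\<lambda>p (x::real). poly p x * exp x)"
  have A: "add_scalar_op (X_op \<circ> D_op) c (\<lambda>x. poly p x * exp x) = (\<lambda>x. poly (Q c p) x * exp x)" for c p
    by (subst euler_op_mult_exp[OF poly_DERIV]) (simp add: Q_def)
  have Q_commute: "Q c (Q d p) = Q d (Q c p)" for c d p
    by (simp add: Q_def pderiv_add pderiv_smult pderiv_pCons smult_add_right algebra_simps)
  have "degen_ffact_op l T n (add_scalar_op T (- (real n * l)) exp) =
      add_scalar_op T (- (real n * l)) (degen_ffact_op l T n exp)"
  proof (rule degen_ffact_op_commute[where S = S])
    show "exp \<in> S"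
      unfolding S_def by (rule range_eqI[of _ _ 1]) simp
  \<comment> \<open>Nested shifts merge into one, so closure follows from \<open>A\<close> and
    commutation from \<open>Q_commute\<close>.\<close>
  qed (auto simp: S_def T_def add_scalar_op_add_scalar_op A Q_commute)
  then show ?thesis
    by simp
qed

lemma degen_ffact_op_exp:
  "degen_ffact_op l (add_scalar_op (X_op \<circ> D_op) (real r)) n exp = (\<lambda>x. degen_r_Bell l r n x * exp x)"
proof (induction n)
  case 0
  show ?case
    by (simp add: degen_r_Bell_0)
next
  case (Suc n)
  \<comment> \<open>Differentiability makes \<open>deriv\<close> a genuine derivative here, as the
    product rule in \<open>euler_op_mult_exp\<close> requires.\<close>
  have D: "(degen_r_Bell l r n has_real_derivative deriv (degen_r_Bell l r n) x) (at x)" for x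
    using degen_r_Bell_has_real_derivative by (metis DERIV_imp_deriv)
  show ?case
    unfolding degen_ffact_op_Suc_exp Suc.IH add_scalar_op_add_scalar_op euler_op_mult_exp[OF D]
    by (simp add: degen_r_Bell_Suc)
qed

theorem theorem2p3:
  fixes l :: real and n r :: nat
  assumes "l \<noteq> 0"
  shows "(\<lambda>x::real. 1 / exp x *
            degen_ffact_op l (add_scalar_op (X_op \<circ> D_op) (real r)) n exp x)
         = degen_r_Bell l r n"
  by (simp add: degen_ffact_op_exp)

end
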